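(* Let $q$ be an odd prime power and $m\ge2$ an integer with $m\mid q+1$. For the subgraph of $\mathrm{GP}(q^2,m)$ induced by $\alpha Q$ the following hold. (1) If $m$ is odd, then $\alpha Q_0$ is a clique and $\alpha Q_1,\dots,\alpha Q_{m-1}$ are independent sets; for any $0\le i_1<i_2\le m-1$, all possible edges are present between $\alpha Q_{i_1}$ and $\alpha Q_{i_2}$ if $i_1+i_2\equiv0\pmod m$ and no such edges exist otherwise. In particular $\alpha Q_1\cup\alpha Q_{m-1},\dots,\alpha Q_{\frac{m-1}2}\cup\alpha Q_{\frac{m+1}2}$ induce $\frac{m-1}2$ complete bipartite graphs. (2) If $m$ is even, then $\alpha Q_0$ and $\alpha Q_{m/2}$ are cliques and $\alpha Q_1,\dots,\alpha Q_{\frac m2-1},\alpha Q_{\frac m2+1},\dots,\alpha Q_{m-1}$ are independent sets; for any $0\le i_1<i_2\le m-1$, all possible edges are present between $\alpha Q_{i_1}$ and $\alpha Q_{i_2}$ if $i_1+i_2\equiv0\pmod m$ and no such edges exist otherwise. In particular, if $m>2$, then $\alpha Q_1\cup\alpha Q_{m-1},\dots,\alpha Q_{\frac m2-1}\cup\alpha Q_{\frac m2+1}$ induce $\frac m2-1$ complete bipartite graphs.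
   Context: The generalised Paley graph $\mathrm{GP}(q^2,m)$ has vertex set $\mathbb{F}_{q^2}$, with two distinct vertices $x,y$ adjacent iff $x-y$ is an $m$-th power of an element of $\mathbb{F}_{q^2}^*$. Fix a non-square $d\in\mathbb{F}_q^*$ and $\alpha\in\mathbb{F}_{q^2}$ with $\alpha^2=d$. Fix a primitive element $\beta$ of $\mathbb{F}_{q^2}$, let $\omega=\beta^{q-1}$, $Q=\langle\omega\rangle$, $Q_0=\langle\omega^m\rangle$, and $Q_i=\omega^iQ_0$ for $0\le i\le m-1$; for a set $S$, $\alpha S=\{\alpha s:s\in S\}$. *)

theory Defs
  imports Complex_Main "HOL-Number_Theory.Number_Theory" "HOL-Library.Ramsey"
begin

text \<open>Undirected simple graphs; an edge is a two-element set of vertices, the edge format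
  used by \<^const>\<open>clique\<close> and \<^const>\<open>indep\<close>.\<close>

record 'a ugraph =
  uverts :: "'a set"
  uedges :: "'a set set"

definition induced :: "'a ugraph \<Rightarrow> 'a set \<Rightarrow> 'a ugraph" where
  "induced G S = \<lparr>uverts = uverts G \<inter> S, uedges = {e \<in> uedges G. e \<subseteq> S}\<rparr>"

definition clique_in :: "'a ugraph \<Rightarrow> 'a set \<Rightarrow> bool" where
  "clique_in G S \<longleftrightarrow> S \<subseteq> uverts G \<and> clique S (uedges G)"

definition indep_in :: "'a ugraph \<Rightarrow> 'a set \<Rightarrow> bool" where
  "indep_in G S \<longleftrightarrow> S \<subseteq> uverts G \<and> indep S (uedges G)"

definition all_edges_between :: "'a ugraph \<Rightarrow> 'a set \<Rightarrow> 'a set \<Rightarrow> bool" where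
  "all_edges_between G S T \<longleftrightarrow> (\<forall>x\<in>S. \<forall>y\<in>T. {x, y} \<in> uedges G)"

definition no_edges_between :: "'a ugraph \<Rightarrow> 'a set \<Rightarrow> 'a set \<Rightarrow> bool" where
  "no_edges_between G S T \<longleftrightarrow> (\<forall>x\<in>S. \<forall>y\<in>T. {x, y} \<notin> uedges G)"

definition complete_bipartite :: "'a ugraph \<Rightarrow> 'a set \<Rightarrow> 'a set \<Rightarrow> bool" where
  "complete_bipartite G S T \<longleftrightarrow>
     S \<noteq> {} \<and> T \<noteq> {} \<and> S \<inter> T = {} \<and> uverts G = S \<union> T \<and>
     uedges G = {{x, y} | x y. x \<in> S \<and> y \<in> T}"

text \<open>The finite field is the whole type. When its order is \<open>q\<^sup>2\<close> with \<open>q\<close> odd and \<open>m\<close> divides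
  \<open>q + 1\<close>, the element \<open>-1\<close> is an \<open>m\<close>-th power, so the condition on \<open>x - y\<close> is symmetric and
  unordered edges represent it without loss.\<close>

definition gen_paley :: "nat \<Rightarrow> 'a::{field,finite} ugraph" where
  "gen_paley m = \<lparr>uverts = UNIV,
     uedges = {{x, y} | x y. x \<noteq> y \<and> (\<exists>z. z \<noteq> 0 \<and> x - y = z ^ m)}\<rparr>"

definition is_subfield :: "'a::field set \<Rightarrow> bool" where
  "is_subfield K \<longleftrightarrow> 0 \<in> K \<and> 1 \<in> K \<and>
     (\<forall>x\<in>K. \<forall>y\<in>K. x - y \<in> K \<and> x * y \<in> K) \<and> (\<forall>x\<in>K. inverse x \<in> K)"

text \<open>The subgroup of the multiplicative group generated by a nonzero element.\<close>

definition cyclic_subgroup :: "'a::field \<Rightarrow> 'a set" where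
  "cyclic_subgroup x = range (\<lambda>k::int. x powi k)"

definition primitive_elt :: "'a::{field,finite} \<Rightarrow> bool" where
  "primitive_elt b \<longleftrightarrow> b \<noteq> 0 \<and> cyclic_subgroup b = UNIV - {0}"

end

theory Submission
  imports Defs "HOL-Computational_Algebra.Polynomial"
begin

text \<open>Two vertices of \<open>\<alpha>Q\<close> are \<open>x = \<alpha>u\<close> and \<open>y = \<alpha>v\<close> with \<open>u = \<omega>\<^sup>a\<close>, \<open>v = \<omega>\<^sup>b\<close>. Since
  \<open>u\<^sup>q = u\<^sup>-\<^sup>1\<close> on \<open>Q\<close> and \<open>\<alpha>\<^sup>q = -\<alpha>\<close>, the Frobenius map gives \<open>(x - y)\<^sup>q = (x - y) / (uv)\<close>,
  that is, \<open>(x - y)\<^bsup>q-1\<^esup> = \<omega>\<^bsup>-(a+b)\<^esup>\<close>. If \<open>x - y = \<beta>\<^sup>j\<close>, the left-hand side is \<open>\<omega>\<^sup>j\<close>; as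
  \<open>\<omega>\<close> has order \<open>q + 1\<close> and \<open>m\<close> divides \<open>q + 1\<close>, this yields \<open>j \<equiv> -(a + b)\<close> modulo \<open>m\<close>.
  So \<open>x\<close> and \<open>y\<close> are adjacent iff \<open>m\<close> divides \<open>a + b\<close>, which depends only on the classes of
  \<open>x\<close> and \<open>y\<close>.\<close>

section \<open>Finite fields\<close>

text \<open>Multiplication by \<open>c\<close> permutes \<open>S\<close>, so \<open>\<Prod>S\<close>
  equals \<open>c ^ card S\<close> times itself and, being nonzero, cancels. Used for the units of
  the field and of a subfield.\<close>

lemma power_card_eq_one:
  fixes c :: "'a::field"
  assumes "finite S" "0 \<notin> S" "c \<noteq> 0" "(*) c ` S = S"
  shows "c ^ card S = 1"
proof -
  have "inj_on ((*) c) S" using assms(3) by (auto intro: inj_onI)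
  then have "\<Prod>((*) c ` S) = (\<Prod>x\<in>S. c * x)" by (simp add: prod.reindex)
  then have "\<Prod>S = c ^ card S * \<Prod>S" by (simp add: assms(4) prod.distrib)
  moreover have "\<Prod>S \<noteq> 0" using assms(1,2) by auto
  ultimately show ?thesis by simp
qed

lemma field_power_card_minus_one:
  fixes x :: "'a::{field,finite}"
  assumes "x \<noteq> 0"
  shows "x ^ (card (UNIV :: 'a set) - 1) = 1"
proof -
  have "(*) x ` (UNIV - {0}) = UNIV - {0}"
  proof (intro equalityI subsetI)
    fix y :: 'a assume "y \<in> UNIV - {0}"
    then have "y = x * (y / x)" "y / x \<in> UNIV - {0}" using assms by auto
    then show "y \<in> (*) x ` (UNIV - {0})" by blast
  qed (use assms in auto)
  from power_card_eq_one[OF _ _ assms this] show ?thesis by (simp add: card_Diff_singleton)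
qed

lemma subfield_power_card:
  assumes "is_subfield K" "finite K" "x \<in> K"
  shows "x ^ card K = x"
proof (cases "x = 0")
  case True
  \<comment> \<open>The exponent has to be positive, since \<open>0 ^ 0 = 1\<close>.\<close>
  moreover have "card K \<noteq> 0" using assms by auto
  ultimately show ?thesis by simp
next
  case False
  have "(*) x ` (K - {0}) = K - {0}"
  proof (intro equalityI subsetI)
    fix y assume y: "y \<in> K - {0}"
    then have "y = x * (inverse x * y)" "inverse x * y \<in> K - {0}"
      using False assms by (auto simp: is_subfield_def)
    then show "y \<in> (*) x ` (K - {0})" by blast
  qed (use False assms in \<open>auto simp: is_subfield_def\<close>)
  from power_card_eq_one[OF _ _ False this] have "x ^ card (K - {0}) = 1"
    using assms(2) by simp
  moreover have "card K = Suc (card (K - {0}))"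
    using assms by (intro card.remove) (auto simp: is_subfield_def)
  ultimately show ?thesis by simp
qed

text \<open>All elements of \<open>K\<close> are roots of X^|K| - X, which has at most |K| roots, so
  there are no others. Membership in \<open>Fq\<close> thereby becomes invariance under the q-th
  power map.\<close>

lemma subfield_eq_power_fixed:
  fixes K :: "'a::field set"
  assumes "is_subfield K" "finite K"
  shows "K = {x. x ^ card K = x}"
proof (rule card_seteq)
  have "{0, 1} \<subseteq> K" using assms by (auto simp: is_subfield_def)
  then have "card {0, 1 :: 'a} \<le> card K" using assms(2) by (intro card_mono)
  then have gt1: "card K > 1" by simp
  let ?p = "monom 1 (card K) - monom 1 1 :: 'a poly"
  \<comment> \<open>Since \<open>card K > 1\<close>, the second monomial leaves the leading
    coefficient alone.\<close>
  have "coeff ?p (card K) \<noteq> 0" using gt1 by simp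
  then have nz: "?p \<noteq> 0" by (metis coeff_0)
  have eq: "{x :: 'a. x ^ card K = x} = {x. poly ?p x = 0}" by (simp add: poly_monom)
  show "finite {x :: 'a. x ^ card K = x}" unfolding eq by (rule poly_roots_finite[OF nz])
  have "card {x. poly ?p x = 0} \<le> degree ?p" by (rule card_poly_roots_bound[OF nz])
  also have "degree ?p \<le> card K"
    using gt1 by (intro degree_diff_le) (auto simp: degree_monom_eq)
  finally show "card {x :: 'a. x ^ card K = x} \<le> card K" unfolding eq .
  show "K \<subseteq> {x. x ^ card K = x}" using subfield_power_card[OF assms] by blast
qed

text \<open>The characteristic is prime and divides a power of the prime below \<open>q\<close>,
  hence equals it, and the freshman's dream applies.\<close>

lemma frobenius_diff:
  fixes x y :: "'a::{field,finite}"
  assumes "primepow q" "card (UNIV :: 'a set) = q ^ e"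
  shows "(x - y) ^ q = x ^ q - y ^ q"
proof -
  obtain p k where p: "prime p" "q = p ^ k"
    using assms(1) by (auto simp: primepow_def)
  have char: "prime CHAR('a)"
    by (intro prime_CHAR_semidom finite_imp_CHAR_pos) auto
  have "CHAR('a) dvd p ^ (k * e)"
    using CHAR_dvd_CARD[where 'a = 'a] assms(2) p by (simp add: power_mult)
  then have "CHAR('a) = p"
    using char p(1) prime_dvd_power primes_dvd_imp_eq by blast
  \<comment> \<open>Expanding the sum \<open>(x - y) + y\<close> avoids the sign of
    \<open>(- 1) ^ q\<close>.\<close>
  then have "(x - y + y) ^ q = (x - y) ^ q + y ^ q"
    using char p by (intro freshmans_dream') auto
  then show ?thesis by (simp add: algebra_simps)
qed

text \<open>The order of \<open>b\<close> is the full number of units: a smaller period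
  \<open>r\<close> would leave at most \<open>r\<close> distinct powers, too few to cover
  them.\<close>

lemma primitive_elt_powi_eq_one_iff:
  fixes b :: "'a::{field,finite}"
  assumes "primitive_elt b"
  shows "b powi k = 1 \<longleftrightarrow> int (card (UNIV :: 'a set) - 1) dvd k"
proof -
  define n where "n = card (UNIV :: 'a set) - 1"
  have b: "b \<noteq> 0" "cyclic_subgroup b = UNIV - {0}"
    using assms by (auto simp: primitive_elt_def)
  have bn: "b ^ n = 1" unfolding n_def by (rule field_power_card_minus_one[OF b(1)])
  have cn: "card (cyclic_subgroup b) = n"
    unfolding b(2) n_def by (rule card_Diff_singleton) simp
  have "1 \<in> cyclic_subgroup b" unfolding b(2) by simp
  then have npos: "n > 0" unfolding cn[symmetric] by (subst card_gt_0_iff) auto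
  \<comment> \<open>Needed for two periods: \<open>n\<close>, to reduce \<open>k\<close> to its
    remainder, and then that remainder, to bound the subgroup.\<close>
  have red: "b powi j = b ^ nat (j mod int r)" if "b ^ r = 1" "r > 0" for j r
  proof -
    have "b powi j = b powi (int r * (j div int r) + j mod int r)"
      by (simp only: mult_div_mod_eq)
    also have "\<dots> = b powi (int r * (j div int r)) * b powi (j mod int r)"
      using b(1) by (intro power_int_add) blast
    also have "b powi (int r * (j div int r)) = (b powi int r) powi (j div int r)"
      by (rule power_int_mult)
    also have "\<dots> * b powi (j mod int r) = b powi (j mod int r)" using that(1) by simp
    also have "\<dots> = b ^ nat (j mod int r)" using that(2) by (simp add: power_int_nonneg_exp)
    finally show ?thesis .
  qed
  have "int n dvd k" if k: "b powi k = 1"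
  proof (rule ccontr)
    assume "\<not> int n dvd k"
    define r where "r = nat (k mod int n)"
    have "k mod int n \<noteq> 0" using \<open>\<not> int n dvd k\<close> by (simp only: dvd_eq_mod_eq_0 not_False_eq_True)
    moreover have "0 \<le> k mod int n" "k mod int n < int n" using npos by simp_all
    ultimately have r: "0 < r" "r < n" unfolding r_def by linarith+
    have "b ^ r = 1" using red[OF bn npos, of k] k unfolding r_def by argo
    have "cyclic_subgroup b \<subseteq> (^) b ` {..<r}"
    proof
      fix y assume "y \<in> cyclic_subgroup b"
      then obtain j where "y = b powi j" by (auto simp: cyclic_subgroup_def)
      then have "y = b ^ nat (j mod int r)" using red \<open>b ^ r = 1\<close> r(1) by blast
      moreover have "nat (j mod int r) < r" using r(1) by (simp add: nat_less_iff)
      ultimately show "y \<in> (^) b ` {..<r}" by blast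
    qed
    then have "card (cyclic_subgroup b) \<le> card ((^) b ` {..<r})" by (intro card_mono) auto
    also have "\<dots> \<le> r" using card_image_le[of "{..<r}" "(^) b"] by simp
    finally show False using cn r(2) by simp
  qed
  moreover have "b powi k = 1" if "int n dvd k"
    using that bn by (metis dvdE power_int_mult power_int_of_nat power_int_1_left)
  ultimately show ?thesis unfolding n_def by blast
qed

section \<open>Graphs with adjacency determined by residue classes\<close>

text \<open>Separates the combinatorics from the field arithmetic. With \<open>i = j\<close>,
  \<open>adjacent_iff\<close> also governs edges inside one class.\<close>

locale residue_class_graph =
  fixes m :: nat and G :: "'a ugraph" and C :: "nat \<Rightarrow> 'a set"
  assumes class_subset: "C i \<subseteq> uverts G"
    and class_nonempty: "C i \<noteq> {}"
    and class_disjoint: "\<not> [i = j] (mod m) \<Longrightarrow> C i \<inter> C j = {}"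
    and edge_pair: "e \<in> uedges G \<Longrightarrow> \<exists>x y. x \<noteq> y \<and> e = {x, y}"
    and adjacent_iff: "\<lbrakk>x \<in> C i; y \<in> C j; x \<noteq> y\<rbrakk> \<Longrightarrow> {x, y} \<in> uedges G \<longleftrightarrow> [i + j = 0] (mod m)"
begin

lemma class_clique: "[i + i = 0] (mod m) \<Longrightarrow> clique_in G (C i)"
  using class_subset adjacent_iff by (auto simp: clique_in_def clique_def)

lemma class_indep: "\<not> [i + i = 0] (mod m) \<Longrightarrow> indep_in G (C i)"
  using class_subset adjacent_iff by (auto simp: indep_in_def indep_def)

lemma classes_disjoint: "\<lbrakk>i < m; j < m; i \<noteq> j\<rbrakk> \<Longrightarrow> C i \<inter> C j = {}"
  using class_disjoint cong_less_modulus_unique_nat by blast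

lemma edges_between_classes:
  assumes "i < m" "j < m" "i \<noteq> j"
  shows "if [i + j = 0] (mod m) then all_edges_between G (C i) (C j)
         else no_edges_between G (C i) (C j)"
proof -
  have "{x, y} \<in> uedges G \<longleftrightarrow> [i + j = 0] (mod m)" if "x \<in> C i" "y \<in> C j" for x y
    using that classes_disjoint[OF assms] by (intro adjacent_iff) auto
  then show ?thesis by (simp add: all_edges_between_def no_edges_between_def)
qed

lemma uverts_induced_pair: "uverts (induced G (C i \<union> C j)) = C i \<union> C j"
  using class_subset by (auto simp: induced_def)

text \<open>The indices sum to \<open>m\<close>, so all cross pairs are edges; neither index doubled
  is a multiple of \<open>m\<close>, so each side is independent.\<close>

lemma complete_bipartite_classes:
  assumes "0 < i" "2 * i < m"
  shows "complete_bipartite (induced G (C i \<union> C (m - i))) (C i) (C (m - i))"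
proof -
  define j where "j = m - i"
  have ij: "i < m" "j < m" "i \<noteq> j" "i + j = m" "i < j" using assms by (auto simp: j_def)
  have disj: "C i \<inter> C j = {}" using classes_disjoint ij by blast
  have i: "\<not> [i + i = 0] (mod m)" using assms by (auto simp: cong_0_iff dest: dvd_imp_le)
  have j: "\<not> [j + j = 0] (mod m)"
  proof
    assume "[j + j = 0] (mod m)"
    \<comment> \<open>This difference is \<open>m - 2 * i\<close>, strictly between 0 and
      \<open>m\<close>.\<close>
    then have "m dvd (j + j) - m" by (simp add: cong_0_iff)
    then show False using ij by (auto dest: dvd_imp_le)
  qed
  have cross: "{x, y} \<in> uedges G" if "x \<in> C i" "y \<in> C j" for x y
    using adjacent_iff[OF that] disj that ij by (auto simp: cong_0_iff)
  have "e \<in> {{x, y} |x y. x \<in> C i \<and> y \<in> C j}" if e: "e \<in> uedges G" "e \<subseteq> C i \<union> C j" for e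
  proof -
    obtain x y where xy: "x \<noteq> y" "e = {x, y}" using edge_pair e by blast
    have "\<not> (x \<in> C i \<and> y \<in> C i)" "\<not> (x \<in> C j \<and> y \<in> C j)"
      using adjacent_iff xy e i j by blast+
    then have "x \<in> C i \<and> y \<in> C j \<or> y \<in> C i \<and> x \<in> C j" using e xy by auto
    then show ?thesis using xy by (auto simp: insert_commute)
  qed
  then show ?thesis
    using disj class_nonempty class_subset cross
    unfolding complete_bipartite_def j_def[symmetric] uverts_induced_pair
    by (auto simp: induced_def)
qed

text \<open>Justifies counting the bipartite graphs by their indices: different indices give
  different vertex sets.\<close>

lemma card_induced_class_pairs:
  assumes "2 * n < m"
  shows "card ((\<lambda>i. induced G (C i \<union> C (m - i))) ` {1..n}) = n"
proof -
  have "inj_on (\<lambda>i. induced G (C i \<union> C (m - i))) {1..n}"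
  proof (rule inj_onI, rule ccontr)
    fix i j assume i: "i \<in> {1..n}" and j: "j \<in> {1..n}" and "i \<noteq> j"
      and "induced G (C i \<union> C (m - i)) = induced G (C j \<union> C (m - j))"
    then have "C i \<union> C (m - i) = C j \<union> C (m - j)" by (metis uverts_induced_pair)
    \<comment> \<open>Here \<open>i \<noteq> m - j\<close> because
      \<open>i + j \<le> 2 * n < m\<close>. So the nonempty \<open>C i\<close> misses the union that
      should contain it.\<close>
    moreover have "C i \<inter> C j = {}" "C i \<inter> C (m - j) = {}"
      using i j \<open>i \<noteq> j\<close> assms by (intro classes_disjoint; auto)+
    ultimately show False using class_nonempty[of i] by blast
  qed
  then show ?thesis by (simp add: card_image)
qed

end

section \<open>The subgraph induced by \<open>\<alpha>Q\<close>\<close>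

text \<open>That \<open>d\<close> is a non-square of \<open>Fq\<close> enters as
  \<open>\<alpha> \<notin> Fq\<close> together with \<open>\<alpha> ^ 2 \<in> Fq\<close>.\<close>

locale paley_coset =
  fixes q m :: nat and Fq :: "'a::{field,finite} set" and \<alpha> \<beta> :: 'a
  assumes q: "primepow q" and m: "m dvd q + 1"
    and card_field: "card (UNIV :: 'a set) = q ^ 2"
    and Fq: "is_subfield Fq" "card Fq = q"
    and \<alpha>: "\<alpha> ^ 2 \<in> Fq" "\<alpha> \<notin> Fq"
    and \<beta>: "primitive_elt \<beta>"
begin

section \<open>The order of \<omega>, and the q-th power map on \<alpha> and on
  \<open>Q\<close>\<close>

definition \<omega> where "\<omega> = \<beta> ^ (q - 1)"

lemma q_gt_1: "q > 1"
  using q primepow_gt_Suc_0 by auto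

lemma nonzero [simp]: "\<beta> \<noteq> 0" "\<omega> \<noteq> 0" "\<alpha> \<noteq> 0"
  using \<beta> \<alpha> Fq by (auto simp: primitive_elt_def is_subfield_def \<omega>_def)

lemma card_units: "q ^ 2 - 1 = (q - 1) * (q + 1)"
  using q_gt_1 by (simp add: power2_eq_square algebra_simps)

text \<open>\<beta> has order \<open>(q - 1) * (q + 1)\<close>; cancelling \<open>q - 1\<close>
  leaves order \<open>q + 1\<close> for its power \<omega>.\<close>

lemma \<omega>_powi_eq_one_iff: "\<omega> powi k = 1 \<longleftrightarrow> int (q + 1) dvd k"
proof -
  have 1: "\<omega> powi k = \<beta> powi (int (q - 1) * k)"
    unfolding \<omega>_def by (rule power_int_power)
  have 2: "int (q ^ 2 - 1) = int (q - 1) * int (q + 1)"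
    unfolding card_units by (rule of_nat_mult)
  have 3: "int (q - 1) * int (q + 1) dvd int (q - 1) * k \<longleftrightarrow> int (q + 1) dvd k"
    by (subst dvd_mult_cancel_left) (use q_gt_1 in simp)
  show ?thesis
    unfolding 1 primitive_elt_powi_eq_one_iff[OF \<beta>] card_field 2 by (rule 3)
qed

lemma \<omega>_powi_eq_iff: "\<omega> powi j = \<omega> powi k \<longleftrightarrow> [j = k] (mod int (q + 1))"
proof -
  have 1: "\<omega> powi j / \<omega> powi k = \<omega> powi (j - k)"
    by (rule power_int_diff[symmetric]) simp
  have 2: "\<omega> powi j = \<omega> powi k \<longleftrightarrow> \<omega> powi j / \<omega> powi k = 1"
    by (rule right_inverse_eq[symmetric]) simp
  show ?thesis
    unfolding 2 unfolding 1 cong_iff_dvd_diff by (rule \<omega>_powi_eq_one_iff)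
qed

text \<open>The q-th power map fixes \<open>\<alpha>\<^sup>2\<close>, so it sends \<alpha> to itself
  or its negative; fixing \<alpha> would put it in \<open>Fq\<close>.\<close>

lemma \<alpha>_power_q: "\<alpha> ^ q = - \<alpha>"
proof -
  have fixed: "Fq = {x. x ^ q = x}" using subfield_eq_power_fixed[OF Fq(1)] Fq(2) by simp
  have "(\<alpha> ^ q)\<^sup>2 = (\<alpha>\<^sup>2) ^ q" by (simp add: mult.commute flip: power_mult)
  also have "\<dots> = \<alpha>\<^sup>2" using \<alpha>(1) fixed by simp
  finally have "(\<alpha> ^ q)\<^sup>2 = \<alpha>\<^sup>2" .
  then have "\<alpha> ^ q = \<alpha> \<or> \<alpha> ^ q = - \<alpha>" by (simp add: power2_eq_iff)
  then show ?thesis using \<alpha>(2) fixed by auto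
qed

lemma \<omega>_powi_power_q: "(\<omega> powi a) ^ q = inverse (\<omega> powi a)"
proof -
  have "\<omega> powi (a * int q) = \<omega> powi (- a)"
    \<comment> \<open>The exponents differ by \<open>a * (q + 1)\<close>, whence the cofactor
      \<open>a\<close>.\<close>
    unfolding \<omega>_powi_eq_iff cong_iff_dvd_diff by (auto simp: algebra_simps intro: dvdI[of _ _ a])
  then show ?thesis by (simp add: power_int_power' power_int_minus)
qed

text \<open>Exponents of \<beta> matter only modulo \<open>q ^ 2 - 1\<close>, a multiple of
  \<open>m\<close>, so their residue modulo \<open>m\<close> is well defined.\<close>

lemma is_power_iff: "(\<exists>z. z \<noteq> 0 \<and> \<beta> powi j = z ^ m) \<longleftrightarrow> int m dvd j"
proof
  assume "\<exists>z. z \<noteq> 0 \<and> \<beta> powi j = z ^ m"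
  then obtain z where z: "z \<noteq> 0" "\<beta> powi j = z ^ m" by blast
  then obtain i where "z = \<beta> powi i"
    using \<beta> by (auto simp: primitive_elt_def cyclic_subgroup_def)
  then have "\<beta> powi (j - i * int m) = 1"
    using z by (simp add: power_int_diff power_int_power')
  then have "int (q ^ 2 - 1) dvd j - i * int m"
    by (simp only: primitive_elt_powi_eq_one_iff[OF \<beta>] card_field)
  moreover have "int m dvd int (q ^ 2 - 1)"
    unfolding card_units int_dvd_int_iff using m by (rule dvd_mult)
  ultimately have "int m dvd (j - i * int m) + i * int m"
    by (intro dvd_add dvd_triv_right) (rule dvd_trans)
  then show "int m dvd j" by simp
next
  assume "int m dvd j"
  then obtain i where "j = i * int m" by (metis dvdE mult.commute)
  then have "\<beta> powi j = (\<beta> powi i) ^ m" by (simp add: power_int_power')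
  then show "\<exists>z. z \<noteq> 0 \<and> \<beta> powi j = z ^ m" by (auto intro!: exI[of _ "\<beta> powi i"])
qed

lemma diff_is_power_iff:
  assumes "\<omega> powi a \<noteq> \<omega> powi b"
  shows "(\<exists>z. z \<noteq> 0 \<and> \<alpha> * \<omega> powi a - \<alpha> * \<omega> powi b = z ^ m) \<longleftrightarrow> int m dvd a + b"
proof -
  define u v where "u = \<omega> powi a" and "v = \<omega> powi b"
  have nz: "u \<noteq> 0" "v \<noteq> 0" "u \<noteq> v" using assms by (auto simp: u_def v_def)
  define w where "w = \<alpha> * u - \<alpha> * v"
  have w: "w \<noteq> 0" using nz by (simp add: w_def)
  then obtain j where j: "w = \<beta> powi j"
    using \<beta> by (auto simp: primitive_elt_def cyclic_subgroup_def)
  have "w ^ q = (\<alpha> * u) ^ q - (\<alpha> * v) ^ q"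
    unfolding w_def by (rule frobenius_diff[OF q card_field])
  also have "\<dots> = - \<alpha> * inverse u + \<alpha> * inverse v"
    using \<omega>_powi_power_q by (simp add: power_mult_distrib \<alpha>_power_q u_def v_def)
  \<comment> \<open>The sign in \<open>\<alpha> ^ q = - \<alpha>\<close> cancels the one in 1/u -
    1/v = -(u - v)/(uv).\<close>
  also have "\<dots> = w * inverse (u * v)" using nz by (simp add: w_def field_simps)
  finally have "w * w ^ (q - 1) = w * inverse (u * v)"
    using q_gt_1 by (simp flip: power_Suc)
  then have "w ^ (q - 1) = inverse (u * v)" using w by simp
  moreover have "w ^ (q - 1) = \<omega> powi j"
    by (simp add: j \<omega>_def power_int_power power_int_power' mult.commute)
  moreover have "inverse (u * v) = \<omega> powi (- (a + b))"
    unfolding u_def v_def power_int_minus by (simp add: power_int_add)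
  ultimately have "[j = - (a + b)] (mod int (q + 1))"
    using \<omega>_powi_eq_iff by metis
  then have "int (q + 1) dvd j + (a + b)" by (simp only: cong_iff_dvd_diff diff_minus_eq_add)
  then have "int m dvd j + (a + b)"
    using m by (meson dvd_trans int_dvd_int_iff)
  then have "int m dvd j \<longleftrightarrow> int m dvd a + b"
    by (meson dvd_add_right_iff dvd_add_left_iff)
  then show ?thesis using is_power_iff j by (simp add: w_def u_def v_def)
qed

section \<open>The classes as sets of exponents, and adjacency between them\<close>

definition paley_class :: "nat \<Rightarrow> 'a set" where
  "paley_class i = (*) \<alpha> ` (*) (\<omega> ^ i) ` cyclic_subgroup (\<omega> ^ m)"

lemma paley_class_eq:
  "paley_class i = {\<alpha> * \<omega> powi (int i + int m * k) | k. True}"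
  by (auto simp: paley_class_def cyclic_subgroup_def power_int_add power_int_power)

definition paley_graph where
  "paley_graph = induced (gen_paley m) ((*) \<alpha> ` cyclic_subgroup \<omega>)"

text \<open>An unordered edge allows either sign of the difference; both give the same condition, as
  \<open>a + b\<close> is symmetric.\<close>

lemma edge_iff:
  assumes "\<omega> powi a \<noteq> \<omega> powi b"
  shows "{\<alpha> * \<omega> powi a, \<alpha> * \<omega> powi b} \<in> uedges paley_graph \<longleftrightarrow> int m dvd a + b"
proof -
  let ?P = "\<lambda>x y. \<exists>z. z \<noteq> 0 \<and> x - y = z ^ m"
  have "{\<alpha> * \<omega> powi a, \<alpha> * \<omega> powi b} \<in> uedges paley_graph \<longleftrightarrow>
      ?P (\<alpha> * \<omega> powi a) (\<alpha> * \<omega> powi b) \<or> ?P (\<alpha> * \<omega> powi b) (\<alpha> * \<omega> powi a)"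
    using assms unfolding paley_graph_def induced_def gen_paley_def cyclic_subgroup_def
    by (simp add: doubleton_eq_iff) (metis nonzero(3) mult_left_cancel)
  also have "\<dots> \<longleftrightarrow> int m dvd a + b"
    using diff_is_power_iff[OF assms] diff_is_power_iff[OF assms[symmetric]]
    by (simp add: add.commute)
  finally show ?thesis .
qed

sublocale residue_class_graph m paley_graph paley_class
proof
  fix i :: nat
  show "paley_class i \<subseteq> uverts paley_graph"
    by (auto simp: paley_class_eq paley_graph_def induced_def gen_paley_def cyclic_subgroup_def)
  show "paley_class i \<noteq> {}" by (auto simp: paley_class_eq)
next
  fix i j :: nat assume ij: "\<not> [i = j] (mod m)"
  show "paley_class i \<inter> paley_class j = {}"
  proof (rule ccontr)
    assume "paley_class i \<inter> paley_class j \<noteq> {}"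
    then obtain k l where "\<omega> powi (int i + int m * k) = \<omega> powi (int j + int m * l)"
      by (auto simp: paley_class_eq)
    \<comment> \<open>Equal powers of \<omega> have exponents congruent modulo \<open>q + 1\<close>,
      hence modulo its divisor \<open>m\<close>.\<close>
    then have "[int i + int m * k = int j + int m * l] (mod int m)"
      unfolding \<omega>_powi_eq_iff using m by (meson cong_dvd_modulus int_dvd_int_iff)
    then have "[int i = int j] (mod int m)" by (simp add: cong_def)
    then show False using ij by (simp add: cong_int_iff)
  qed
next
  fix e assume "e \<in> uedges paley_graph"
  then show "\<exists>x y. x \<noteq> y \<and> e = {x, y}"
    by (auto simp: paley_graph_def induced_def gen_paley_def)
next
  fix i j x y assume x: "x \<in> paley_class i" and y: "y \<in> paley_class j" and "x \<noteq> y"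
  obtain k where k: "x = \<alpha> * \<omega> powi (int i + int m * k)" using x by (auto simp: paley_class_eq)
  obtain l where l: "y = \<alpha> * \<omega> powi (int j + int m * l)" using y by (auto simp: paley_class_eq)
  have "{x, y} \<in> uedges paley_graph \<longleftrightarrow>
      int m dvd (int i + int m * k) + (int j + int m * l)"
    unfolding k l by (rule edge_iff) (use \<open>x \<noteq> y\<close> k l in auto)
  also have "(int i + int m * k) + (int j + int m * l) = int (i + j) + int m * (k + l)"
    by (simp add: algebra_simps)
  also have "int m dvd \<dots> \<longleftrightarrow> [i + j = 0] (mod m)"
    by (simp only: dvd_add_times_triv_right_iff cong_0_iff int_dvd_int_iff dvd_add_left_iff dvd_triv_left)
  finally show "{x, y} \<in> uedges paley_graph \<longleftrightarrow> [i + j = 0] (mod m)" .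
qed

end

text \<open>The only multiple of \<open>m\<close> strictly between 0 and \<open>2 * m\<close> is
  \<open>m\<close>. This singles out \<open>m div 2\<close> as the exceptional class for even
  \<open>m\<close>.\<close>

lemma double_cong_0_iff:
  fixes i m :: nat
  assumes "0 < i" "i < m"
  shows "[i + i = 0] (mod m) \<longleftrightarrow> 2 * i = m"
proof
  assume "[i + i = 0] (mod m)"
  then obtain k where k: "i + i = m * k" by (auto simp: cong_0_iff)
  then have "k \<noteq> 0" using assms by (intro notI) simp
  moreover have "m * k < m * 2" unfolding k[symmetric] using assms by linarith
  ultimately have "k = 1" by simp
  then show "2 * i = m" using k by simp
qed (auto simp: cong_0_iff mult_2)

theorem theorem4p12:
  fixes q m :: nat
    and Fq :: "'a::{field,finite} set"
    and d \<alpha> \<beta> \<omega> :: 'a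
    and Q :: "'a set"
    and \<alpha>Q :: "nat \<Rightarrow> 'a set"
    and H :: "'a ugraph"
  assumes "primepow q" and "odd q" and "m \<ge> 2" and "m dvd q + 1"
    and "card (UNIV :: 'a set) = q ^ 2"
    and "is_subfield Fq" and "card Fq = q"
    and "d \<in> Fq - {0}" and "\<not> (\<exists>y\<in>Fq. y ^ 2 = d)" and "\<alpha> ^ 2 = d"
    and "primitive_elt \<beta>"
    and "\<omega> = \<beta> ^ (q - 1)"
    and "Q = cyclic_subgroup \<omega>"
    and "\<And>i. \<alpha>Q i = (*) \<alpha> ` ((*) (\<omega> ^ i) ` cyclic_subgroup (\<omega> ^ m))"
    and "H = induced (gen_paley m) ((*) \<alpha> ` Q)"
  shows
    "(odd m \<longrightarrow>
        clique_in H (\<alpha>Q 0) \<and>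
        (\<forall>i\<in>{1..m - 1}. indep_in H (\<alpha>Q i)) \<and>
        (\<forall>i\<^sub>1 i\<^sub>2. i\<^sub>1 < i\<^sub>2 \<and> i\<^sub>2 \<le> m - 1 \<longrightarrow>
           (if [i\<^sub>1 + i\<^sub>2 = 0] (mod m) then all_edges_between H (\<alpha>Q i\<^sub>1) (\<alpha>Q i\<^sub>2)
            else no_edges_between H (\<alpha>Q i\<^sub>1) (\<alpha>Q i\<^sub>2))) \<and>
        (\<forall>i\<in>{1..(m - 1) div 2}.
           complete_bipartite (induced H (\<alpha>Q i \<union> \<alpha>Q (m - i))) (\<alpha>Q i) (\<alpha>Q (m - i))) \<and>
        card ((\<lambda>i. induced H (\<alpha>Q i \<union> \<alpha>Q (m - i))) ` {1..(m - 1) div 2}) = (m - 1) div 2)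
     \<and>
     (even m \<longrightarrow>
        clique_in H (\<alpha>Q 0) \<and> clique_in H (\<alpha>Q (m div 2)) \<and>
        (\<forall>i\<in>{1..m - 1} - {m div 2}. indep_in H (\<alpha>Q i)) \<and>
        (\<forall>i\<^sub>1 i\<^sub>2. i\<^sub>1 < i\<^sub>2 \<and> i\<^sub>2 \<le> m - 1 \<longrightarrow>
           (if [i\<^sub>1 + i\<^sub>2 = 0] (mod m) then all_edges_between H (\<alpha>Q i\<^sub>1) (\<alpha>Q i\<^sub>2)
            else no_edges_between H (\<alpha>Q i\<^sub>1) (\<alpha>Q i\<^sub>2))) \<and>
        (m > 2 \<longrightarrow>
           (\<forall>i\<in>{1..m div 2 - 1}.
              complete_bipartite (induced H (\<alpha>Q i \<union> \<alpha>Q (m - i))) (\<alpha>Q i) (\<alpha>Q (m - i))) \<and>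
           card ((\<lambda>i. induced H (\<alpha>Q i \<union> \<alpha>Q (m - i))) ` {1..m div 2 - 1}) = m div 2 - 1))"
proof -
  \<comment> \<open>Otherwise \<alpha> would be a square root of \<open>d\<close> inside
    \<open>Fq\<close>.\<close>
  have "\<alpha> \<notin> Fq" using assms(9,10) by blast
  then interpret paley_coset q m Fq \<alpha> \<beta>
    using assms by unfold_locales auto
  have H: "H = paley_graph"
    using assms(12,13,15) by (simp add: paley_graph_def \<omega>_def)
  have "\<alpha>Q = paley_class"
    using assms(12,14) by (auto simp: paley_class_def \<omega>_def)
  then interpret residue_class_graph m H \<alpha>Q
    unfolding H using residue_class_graph_axioms by simp
  have clique0: "clique_in H (\<alpha>Q 0)" by (rule class_clique) simp
  have between: "\<forall>i\<^sub>1 i\<^sub>2. i\<^sub>1 < i\<^sub>2 \<and> i\<^sub>2 \<le> m - 1 \<longrightarrow>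
           (if [i\<^sub>1 + i\<^sub>2 = 0] (mod m) then all_edges_between H (\<alpha>Q i\<^sub>1) (\<alpha>Q i\<^sub>2)
            else no_edges_between H (\<alpha>Q i\<^sub>1) (\<alpha>Q i\<^sub>2))"
    using assms(3) by (intro allI impI edges_between_classes) auto
  have indep: "indep_in H (\<alpha>Q i)" if "i \<in> {1..m - 1}" "2 * i \<noteq> m" for i
  proof (rule class_indep)
    have "0 < i" "i < m" using that(1) assms(3) by auto
    then show "\<not> [i + i = 0] (mod m)" using that(2) by (simp add: double_cong_0_iff)
  qed
  have bip: "\<forall>i\<in>{1..n}. complete_bipartite (induced H (\<alpha>Q i \<union> \<alpha>Q (m - i))) (\<alpha>Q i) (\<alpha>Q (m - i))"
    if "2 * n < m" for n
    using that by (intro ballI complete_bipartite_classes) auto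
  show ?thesis
  proof (intro conjI impI)
    assume "odd m"
    then have "2 * i \<noteq> m" for i by auto
    then show "\<forall>i\<in>{1..m - 1}. indep_in H (\<alpha>Q i)" using indep by blast
    \<comment> \<open>For odd \<open>m\<close>, \<open>(m - 1) div 2\<close> is the last index below
      its partner \<open>m - i\<close>.\<close>
    have n: "2 * ((m - 1) div 2) < m" using assms(3) by linarith
    show "card ((\<lambda>i. induced H (\<alpha>Q i \<union> \<alpha>Q (m - i))) ` {1..(m - 1) div 2}) = (m - 1) div 2"
      by (rule card_induced_class_pairs[OF n])
    show "\<forall>i\<in>{1..(m - 1) div 2}.
        complete_bipartite (induced H (\<alpha>Q i \<union> \<alpha>Q (m - i))) (\<alpha>Q i) (\<alpha>Q (m - i))"
      by (rule bip[OF n])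
  next
    assume "even m"
    then show "clique_in H (\<alpha>Q (m div 2))"
      by (intro class_clique) (simp add: cong_0_iff flip: mult_2)
    have "2 * i \<noteq> m" if "i \<noteq> m div 2" for i using that by auto
    then show "\<forall>i\<in>{1..m - 1} - {m div 2}. indep_in H (\<alpha>Q i)" using indep by blast
    \<comment> \<open>The pairs stop before \<open>m div 2\<close>, which would be its own
      partner.\<close>
    have n: "2 * (m div 2 - 1) < m" using assms(3) by linarith
    show "card ((\<lambda>i. induced H (\<alpha>Q i \<union> \<alpha>Q (m - i))) ` {1..m div 2 - 1}) = m div 2 - 1"
      by (rule card_induced_class_pairs[OF n])
    show "\<forall>i\<in>{1..m div 2 - 1}.
        complete_bipartite (induced H (\<alpha>Q i \<union> \<alpha>Q (m - i))) (\<alpha>Q i) (\<alpha>Q (m - i))"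
      by (rule bip[OF n])
  qed (rule clique0 between)+
qed

end
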